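(* Let $\{\varepsilon_t\}_{t\in\mathbb{Z}}$ be a sequence of independent and identically distributed real random variables with mean zero and variance $\sigma^2\in(0,\infty)$, let $\mu,\phi,b\in\mathbb{R}$, and consider the model $$Y_t=\mu+\phi Y_{t-2}+bY_{t-2}\varepsilon_{t-1}+\varepsilon_t,\qquad t\in\mathbb{Z}.$$ Assume $E\ln|\phi+b\varepsilon_1|<0$. Then there exists a unique strictly stationary solution $\{Y_t\}$ to this model, and the solution is ergodic and has the representation $$Y_t=\mu+\varepsilon_t+\sum_{i=1}^\infty\ \prod_{r=0}^{i-1}(\phi+b\varepsilon_{t-2r-1})\,(\mu+\varepsilon_{t-2i}).$$
   Context: The infinite series is understood to converge almost surely. The convention $\ln 0=-\infty$ is used, so $E\ln|\phi+b\varepsilon_1|$ takes values in $[-\infty,\infty)$ (the positive part of the logarithm is integrable because $E\varepsilon_1^2<\infty$). *)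

theory Defs
  imports "HOL-Probability.Probability"
begin

text \<open>
  Logarithm with the convention \<open>ln 0 = -\<infinity>\<close>; the library has \<open>ln 0 = 0\<close> on the reals.
  It is meant for nonnegative arguments.
\<close>

definition ereal_ln :: "real \<Rightarrow> ereal" where
  "ereal_ln x = (if x = 0 then -\<infinity> else ereal (ln x))"

text \<open>
  Expectation of an extended-real random variable as the expectation of the positive part
  minus that of the negative part (\<^const>\<open>e2ennreal\<close> sends negative numbers to 0).
  The value is the mathematical one whenever one of the two is finite. Otherwise it is
  \<open>\<infinity> - \<infinity> = \<infinity>\<close>, so an upper bound below \<open>\<infinity>\<close> on it implies that the positive part is integrable.
\<close>

definition ereal_expectation :: "'a measure \<Rightarrow> ('a \<Rightarrow> ereal) \<Rightarrow> ereal" where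
  "ereal_expectation M f =
     enn2ereal (\<integral>\<^sup>+\<omega>. e2ennreal (f \<omega>) \<partial>M) - enn2ereal (\<integral>\<^sup>+\<omega>. e2ennreal (- f \<omega>) \<partial>M)"

definition strictly_stationary :: "'a measure \<Rightarrow> (int \<Rightarrow> 'a \<Rightarrow> real) \<Rightarrow> bool" where
  "strictly_stationary M Y \<longleftrightarrow>
     (\<forall>t. Y t \<in> borel_measurable M) \<and>
     (\<forall>J h. finite J \<longrightarrow>
        distr M (\<Pi>\<^sub>M t\<in>J. borel) (\<lambda>\<omega>. \<lambda>t\<in>J. Y (t + h) \<omega>) =
        distr M (\<Pi>\<^sub>M t\<in>J. borel) (\<lambda>\<omega>. \<lambda>t\<in>J. Y t \<omega>))"

text \<open>
  Ergodicity of a strictly stationary process: every shift-invariant measurable set of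
  trajectories has probability 0 or 1 under the law of the process.
\<close>

definition path_law :: "'a measure \<Rightarrow> (int \<Rightarrow> 'a \<Rightarrow> real) \<Rightarrow> (int \<Rightarrow> real) measure" where
  "path_law M Y = distr M (\<Pi>\<^sub>M t\<in>UNIV. borel) (\<lambda>\<omega> t. Y t \<omega>)"

definition path_shift :: "(int \<Rightarrow> real) \<Rightarrow> int \<Rightarrow> real" where
  "path_shift y = (\<lambda>t. y (t + 1))"

definition ergodic_process :: "'a measure \<Rightarrow> (int \<Rightarrow> 'a \<Rightarrow> real) \<Rightarrow> bool" where
  "ergodic_process M Y \<longleftrightarrow>
     strictly_stationary M Y \<and>
     (\<forall>A \<in> sets (\<Pi>\<^sub>M t\<in>(UNIV :: int set). (borel :: real measure)).
        path_shift -` A = A \<longrightarrow>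
        measure (path_law M Y) A = 0 \<or> measure (path_law M Y) A = 1)"

definition bilinear_solution ::
    "'a measure \<Rightarrow> (int \<Rightarrow> 'a \<Rightarrow> real) \<Rightarrow> real \<Rightarrow> real \<Rightarrow> real \<Rightarrow> (int \<Rightarrow> 'a \<Rightarrow> real) \<Rightarrow> bool" where
  "bilinear_solution M \<epsilon> \<mu> \<phi> b Y \<longleftrightarrow>
     (\<forall>t. Y t \<in> borel_measurable M) \<and>
     (\<forall>t. AE \<omega> in M. Y t \<omega> = \<mu> + \<phi> * Y (t - 2) \<omega> + b * Y (t - 2) \<omega> * \<epsilon> (t - 1) \<omega> + \<epsilon> t \<omega>)"

text \<open>
  The summand of the series with index \<open>i\<close>; the series runs over \<open>i \<ge> 1\<close>.
\<close>

definition series_term ::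
    "(int \<Rightarrow> 'a \<Rightarrow> real) \<Rightarrow> real \<Rightarrow> real \<Rightarrow> real \<Rightarrow> int \<Rightarrow> 'a \<Rightarrow> nat \<Rightarrow> real" where
  "series_term \<epsilon> \<mu> \<phi> b t \<omega> i =
     (\<Prod>r<i. \<phi> + b * \<epsilon> (t - 2 * int r - 1) \<omega>) * (\<mu> + \<epsilon> (t - 2 * int i) \<omega>)"

end

theory Submission
  imports Defs
begin

text \<open>
  Put \<open>a\<^sub>t = \<bar>\<phi> + b \<epsilon>\<^sub>t\<bar>\<close>. Since \<open>E ln a\<^sub>t < 0\<close> is the right derivative of \<open>s \<mapsto> E a\<^sub>t\<^sup>s\<close> at 0, some
  \<open>s \<in> (0, 1]\<close> has \<open>\<rho> = E a\<^sub>t\<^sup>s < 1\<close>; this replaces the law of large numbers. By independence the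
  \<open>s\<close>-th absolute moment of the \<open>i\<close>-th summand is a constant times \<open>\<rho>\<^sup>i\<close>, so the series of \<open>s\<close>-th powers,
  and because of \<open>s \<le> 1\<close> the series itself, converges absolutely almost surely. The sum is a fixed
  measurable functional of the shifted noise, so it inherits stationarity and ergodicity from the
  Bernoulli shift, which is mixing. Two stationary solutions differ at time \<open>t\<close> by a product of \<open>n\<close>
  coefficients, which tends to 0 in probability, times a difference at time \<open>t - 2 n\<close> that is tight in \<open>n\<close>.
\<close>

section \<open>Fractional moments\<close>

text \<open>The concave function \<open>x powr s\<close> lies below its tangent at 1. Here this is
  the weighted Young inequality with second factor 1 and weights \<open>s\<close> and
  \<open>1 - s\<close>.\<close>

lemma powr_le_linear:
  fixes x s :: real
  assumes "0 \<le> x" "0 < s" "s \<le> 1"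
  shows "x powr s \<le> 1 + s * (x - 1)"
proof (cases "x = 0")
  case False
  then show ?thesis
    using Youngs_inequality_0[of s "1 - s" x 1] assms by (simp add: algebra_simps)
qed (use assms in simp)

text \<open>The derivative of \<open>s \<mapsto> x powr s\<close> at 0 is \<open>ln x\<close>.
  Sampling it along \<open>s = 1 / (n + 1)\<close> gives a sequence to which Fatou's lemma
  applies.\<close>

lemma tendsto_powr_quotient_ln:
  fixes x :: real
  assumes "0 < x"
  shows "(\<lambda>n. (x powr (1 / real (Suc n)) - 1) * real (Suc n)) \<longlonglongrightarrow> ln x"
proof -
  have "((\<lambda>s. x powr s) has_real_derivative ln x) (at 0)"
    using assms by (auto intro!: derivative_eq_intros simp: has_field_derivative_def powr_def)
  then have "(\<lambda>s. (x powr s - 1) / s) \<midarrow>0\<rightarrow> ln x"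
    using assms by (simp add: DERIV_def)
  moreover have "filterlim (\<lambda>n. 1 / real (Suc n)) (at 0) sequentially"
    using LIMSEQ_inverse_real_of_nat by (simp add: filterlim_at inverse_eq_divide)
  ultimately show ?thesis
    by (rule filterlim_compose[THEN tendsto_cong[THEN iffD1, rotated]]) simp
qed

lemma (in prob_space) integrable_powr_le_one:
  fixes X :: "'a \<Rightarrow> real"
  assumes "integrable M X" "\<And>\<omega>. 0 \<le> X \<omega>" "0 < s" "s \<le> 1"
  shows "integrable M (\<lambda>\<omega>. X \<omega> powr s)"
proof (rule Bochner_Integration.integrable_bound[of M "\<lambda>\<omega>. 1 + X \<omega>"])
  have "X \<omega> powr s \<le> 1 + X \<omega>" for \<omega>
  proof -
    have "X \<omega> powr s \<le> 1 + s * (X \<omega> - 1)"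
      using assms by (intro powr_le_linear) auto
    also have "s * (X \<omega> - 1) \<le> X \<omega>"
      using mult_right_mono[OF assms(4) assms(2)[of \<omega>]] assms(3) by (simp add: algebra_simps)
    finally show ?thesis by simp
  qed
  then show "AE \<omega> in M. norm (X \<omega> powr s) \<le> norm (1 + X \<omega>)"
    using assms(2) by (intro AE_I2) (simp add: add_nonneg_nonneg)
qed (use assms in auto)

text \<open>
  The difference quotients \<open>(X\<^sup>s - 1) / s\<close> are at most \<open>X - 1\<close> and tend to \<open>ln X\<close> as \<open>s \<rightarrow> 0\<close>. If all of
  them had nonnegative mean, then so would \<open>ln X\<close>, by Fatou's lemma.
\<close>

lemma (in prob_space) exists_fractional_moment_less_one:
  fixes X :: "'a \<Rightarrow> real"
  assumes X: "integrable M X" and nonneg: "\<And>\<omega>. 0 \<le> X \<omega>"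
    and neg: "ereal_expectation M (\<lambda>\<omega>. ereal_ln (X \<omega>)) < 0"
  shows "\<exists>s. 0 < s \<and> s \<le> 1 \<and> expectation (\<lambda>\<omega>. X \<omega> powr s) < 1"
proof (rule ccontr)
  assume none: "\<not> ?thesis"
  have [measurable]: "X \<in> borel_measurable M"
    using X by simp
  \<comment> \<open>The gap between the tangent bound \<open>X - 1\<close> and the difference
    quotient at \<open>s = 1 / (n + 1)\<close>. It is nonnegative, as Fatou's lemma requires, and
    tends to \<open>X - 1 - ln X\<close> where \<open>X > 0\<close>.\<close>
  define h where "h n \<omega> = (X \<omega> - 1) - (X \<omega> powr (1 / real (Suc n)) - 1) * real (Suc n)" for n \<omega>
  have [measurable]: "h n \<in> borel_measurable M" for n
    unfolding h_def by measurable
  have h_nonneg: "0 \<le> h n \<omega>" for n \<omega>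
    using powr_le_linear[OF nonneg[of \<omega>], of "1 / real (Suc n)"]
    by (simp add: h_def field_simps)
  have pow: "integrable M (\<lambda>\<omega>. X \<omega> powr (1 / real (Suc n)))"
    "1 \<le> expectation (\<lambda>\<omega>. X \<omega> powr (1 / real (Suc n)))" for n
  proof -
    show "integrable M (\<lambda>\<omega>. X \<omega> powr (1 / real (Suc n)))"
      using X nonneg by (intro integrable_powr_le_one) auto
    have "0 < 1 / real (Suc n)" "1 / real (Suc n) \<le> 1" by simp_all
    with none show "1 \<le> expectation (\<lambda>\<omega>. X \<omega> powr (1 / real (Suc n)))"
      using not_le by blast
  qed
  \<comment> \<open>The exponent at \<open>n = 0\<close> is 1. Hence
    \<open>expectation X - 1\<close> is nonnegative, and \<open>ennreal\<close> does not truncate it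
    below.\<close>
  have EX: "1 \<le> expectation X"
    using pow(2)[of 0] nonneg by simp
  have h_int: "(\<integral>\<^sup>+\<omega>. h n \<omega> \<partial>M) \<le> ennreal (expectation X - 1)" for n
  proof -
    have "(\<integral>\<^sup>+\<omega>. h n \<omega> \<partial>M) = ennreal (expectation (h n))"
      using X pow(1) h_nonneg unfolding h_def by (intro nn_integral_eq_integral) auto
    also have "expectation (h n) =
        expectation X - 1 - (expectation (\<lambda>\<omega>. X \<omega> powr (1 / real (Suc n))) - 1) * real (Suc n)"
      using X pow(1)[of n] unfolding h_def by (simp add: prob_space)
    also have "\<dots> \<le> expectation X - 1"
      using pow(2)[of n] by simp
    finally show ?thesis by (simp add: ennreal_leI)
  qed
  \<comment> \<open>Since \<open>0 powr s = 0\<close>, the value of \<open>h n\<close> at a zero of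
    \<open>X\<close> is exactly \<open>n\<close>. The Fatou bound therefore forces \<open>X\<close>
    to be positive almost surely, so the case \<open>ln 0 = -\<infinity>\<close> has probability
    zero.\<close>
  have lim0: "(\<lambda>n. ennreal (h n \<omega>)) \<longlonglongrightarrow> top" if "X \<omega> = 0" for \<omega>
    using that of_nat_tendsto_top_ennreal by (simp add: h_def ennreal_of_nat_eq_real_of_nat)
  have lim1: "(\<lambda>n. ennreal (h n \<omega>)) \<longlonglongrightarrow> ennreal (X \<omega> - 1 - ln (X \<omega>))" if "0 < X \<omega>" for \<omega>
    using that unfolding h_def by (intro tendsto_ennrealI tendsto_diff tendsto_const tendsto_powr_quotient_ln)
  have "(\<integral>\<^sup>+\<omega>. liminf (\<lambda>n. ennreal (h n \<omega>)) \<partial>M) \<le> liminf (\<lambda>n. \<integral>\<^sup>+\<omega>. h n \<omega> \<partial>M)"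
    by (rule nn_integral_liminf) measurable
  also have "\<dots> \<le> ennreal (expectation X - 1)"
    using h_int by (intro Liminf_le) auto
  finally have fatou: "(\<integral>\<^sup>+\<omega>. liminf (\<lambda>n. ennreal (h n \<omega>)) \<partial>M) \<le> ennreal (expectation X - 1)" .
  then have "AE \<omega> in M. liminf (\<lambda>n. ennreal (h n \<omega>)) \<noteq> \<infinity>"
    by (intro nn_integral_PInf_AE) (auto simp: top_unique)
  then have pos: "AE \<omega> in M. 0 < X \<omega>"
  proof eventually_elim
    case (elim \<omega>)
    then have "X \<omega> \<noteq> 0"
      using lim_imp_Liminf[OF sequentially_bot lim0[of \<omega>]] by auto
    then show ?case
      using nonneg[of \<omega>] by simp
  qed
  \<comment> \<open>The limit of \<open>h n\<close>. Its integrability makes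
    \<open>ln X = X - 1 - D\<close> integrable, and its mean is at most
    \<open>expectation X - 1\<close>, so \<open>ln X\<close> has nonnegative mean.\<close>
  define D where "D \<omega> = X \<omega> - 1 - ln (X \<omega>)" for \<omega>
  have [measurable]: "D \<in> borel_measurable M"
    unfolding D_def by measurable
  have D_nonneg: "AE \<omega> in M. 0 \<le> D \<omega>"
    using pos by eventually_elim (simp add: D_def ln_le_minus_one)
  have "(\<integral>\<^sup>+\<omega>. D \<omega> \<partial>M) = (\<integral>\<^sup>+\<omega>. liminf (\<lambda>n. ennreal (h n \<omega>)) \<partial>M)"
    using pos by (intro nn_integral_cong_AE, eventually_elim)
      (simp add: D_def lim_imp_Liminf[OF sequentially_bot lim1])
  with fatou have D_le: "(\<integral>\<^sup>+\<omega>. D \<omega> \<partial>M) \<le> ennreal (expectation X - 1)"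
    by simp
  have D_int: "integrable M D"
    using D_le D_nonneg by (intro integrableI_nonneg) (auto simp: le_less_trans)
  have "expectation D \<le> expectation X - 1"
    using D_le EX by (simp add: nn_integral_eq_integral[OF D_int D_nonneg])
  moreover have ln_eq: "(\<lambda>\<omega>. ln (X \<omega>)) = (\<lambda>\<omega>. X \<omega> - 1 - D \<omega>)"
    by (simp add: D_def)
  ultimately have "integrable M (\<lambda>\<omega>. ln (X \<omega>))" "0 \<le> expectation (\<lambda>\<omega>. ln (X \<omega>))"
    using X D_int unfolding ln_eq by (auto simp: prob_space)
  \<comment> \<open>Both parts of the logarithm have finite integral, so the extended difference in
    \<open>ereal_expectation\<close> is an ordinary real difference and its sign can be
    transferred.\<close>
  then have "(\<integral>\<^sup>+\<omega>. ln (X \<omega>) \<partial>M) \<noteq> top" "(\<integral>\<^sup>+\<omega>. ennreal (- ln (X \<omega>)) \<partial>M) \<noteq> top"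
    "0 \<le> enn2real (\<integral>\<^sup>+\<omega>. ln (X \<omega>) \<partial>M) - enn2real (\<integral>\<^sup>+\<omega>. ennreal (- ln (X \<omega>)) \<partial>M)"
    by (auto simp: real_integrable_def real_lebesgue_integral_def)
  then have "0 \<le> enn2ereal (\<integral>\<^sup>+\<omega>. ln (X \<omega>) \<partial>M) - enn2ereal (\<integral>\<^sup>+\<omega>. ennreal (- ln (X \<omega>)) \<partial>M)"
    by (cases "\<integral>\<^sup>+\<omega>. ln (X \<omega>) \<partial>M"; cases "\<integral>\<^sup>+\<omega>. ennreal (- ln (X \<omega>)) \<partial>M") auto
  moreover have "(\<integral>\<^sup>+\<omega>. e2ennreal (ereal_ln (X \<omega>)) \<partial>M) = (\<integral>\<^sup>+\<omega>. ln (X \<omega>) \<partial>M)"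
    using pos by (intro nn_integral_cong_AE, eventually_elim) (simp add: ereal_ln_def)
  moreover have "(\<integral>\<^sup>+\<omega>. e2ennreal (- ereal_ln (X \<omega>)) \<partial>M) = (\<integral>\<^sup>+\<omega>. ennreal (- ln (X \<omega>)) \<partial>M)"
    using pos by (intro nn_integral_cong_AE, eventually_elim) (simp add: ereal_ln_def)
  ultimately show False
    using neg by (simp add: ereal_expectation_def)
qed

section \<open>Mixing of the Bernoulli shift\<close>

context
  fixes D :: "'b measure"
  assumes D: "prob_space D"
begin

lemma distr_PiM_shift:
  fixes h :: int
  shows "distr (PiM UNIV (\<lambda>_. D)) (PiM UNIV (\<lambda>_. D)) (\<lambda>x t. x (t + h)) = PiM UNIV (\<lambda>_. D)"
  using distr_PiM_reindex[where K=UNIV and I=UNIV and M="\<lambda>_. D" and f="\<lambda>t. t + h"] D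
  by (simp add: restrict_UNIV)

lemma measurable_PiM_shift:
  fixes h :: int
  shows "(\<lambda>x t. x (t + h)) \<in> measurable (PiM UNIV (\<lambda>_. D)) (PiM UNIV (\<lambda>_. D))"
  by (rule measurable_PiM_single') (auto simp: space_PiM PiE_iff)

definition shift_vimage :: "nat \<Rightarrow> (int \<Rightarrow> 'b) set \<Rightarrow> (int \<Rightarrow> 'b) set" where
  "shift_vimage n B = (\<lambda>x t. x (t + int n)) -` B \<inter> space (PiM UNIV (\<lambda>_. D))"

text \<open>Each cylinder restricts finitely many coordinates. Once \<open>n\<close> is large, the
  coordinates of \<open>A\<close> and those of the shifted \<open>B\<close> are disjoint, so the
  product formula holds exactly and the sequence is eventually constant.\<close>

lemma shift_mixing_cylinders:
  assumes "A \<in> prod_algebra UNIV (\<lambda>_::int. D)" "B \<in> prod_algebra UNIV (\<lambda>_. D)"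
  defines "\<nu> \<equiv> measure (PiM UNIV (\<lambda>_::int. D))"
  shows "(\<lambda>n. \<nu> (A \<inter> shift_vimage n B)) \<longlonglongrightarrow> \<nu> A * \<nu> B"
proof -
  interpret product_prob_space "\<lambda>_. D" "UNIV :: int set"
    using D by (intro product_prob_spaceI)
  have cylinder: "emb UNIV J (Pi\<^sub>E J E) = {x \<in> space (PiM UNIV (\<lambda>_. D)). \<forall>j\<in>J. x j \<in> E j}" for J E
    by (auto simp: prod_emb_def space_PiM PiE_iff)
  obtain J E where A: "A = emb UNIV J (Pi\<^sub>E J E)" and J: "finite J" "\<And>j. j \<in> J \<Longrightarrow> E j \<in> sets D"
    using prod_algebraE[OF assms(1)] by metis
  obtain K F where B: "B = emb UNIV K (Pi\<^sub>E K F)" and K: "finite K" "\<And>j. j \<in> K \<Longrightarrow> F j \<in> sets D"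
    using prod_algebraE[OF assms(2)] by metis
  have "\<nu> (A \<inter> shift_vimage n B) = \<nu> A * \<nu> B" if n: "\<And>j k. j \<in> J \<Longrightarrow> k \<in> K \<Longrightarrow> j \<noteq> k + int n" for n
  proof -
    let ?K = "(\<lambda>k. k + int n) ` K"
    \<comment> \<open>The side conditions of both cylinders glued into one family; this is
      consistent because the two coordinate sets are disjoint.\<close>
    let ?G = "\<lambda>j. if j \<in> J then E j else F (j - int n)"
    have disj: "J \<inter> ?K = {}"
      using n by auto
    have "(\<forall>j\<in>J. x j \<in> E j) \<and> (\<forall>k\<in>K. x (k + int n) \<in> F k) \<longleftrightarrow> (\<forall>j\<in>J \<union> ?K. x j \<in> ?G j)" for x
      using disj by (simp add: ball_Un) (metis disjoint_iff imageI)
    moreover have "(\<lambda>t. x (t + int n)) \<in> space (PiM UNIV (\<lambda>_. D))" if "x \<in> space (PiM UNIV (\<lambda>_. D))" for x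
      using that by (rule measurable_space[OF measurable_PiM_shift])
    ultimately have "A \<inter> shift_vimage n B = emb UNIV (J \<union> ?K) (Pi\<^sub>E (J \<union> ?K) ?G)"
      unfolding A B cylinder shift_vimage_def by blast
    moreover have "?G j \<in> sets D" if "j \<in> J \<union> ?K" for j
      using that J(2) K(2) by (cases "j \<in> J") auto
    then have "\<nu> (emb UNIV (J \<union> ?K) (Pi\<^sub>E (J \<union> ?K) ?G)) = (\<Prod>j\<in>J \<union> ?K. measure D (?G j))"
      unfolding \<nu>_def using J(1) K(1) by (intro measure_PiM_emb) simp_all
    ultimately have "\<nu> (A \<inter> shift_vimage n B) = (\<Prod>j\<in>J \<union> ?K. measure D (?G j))"
      by simp
    also have "\<dots> = (\<Prod>j\<in>J. measure D (?G j)) * (\<Prod>j\<in>?K. measure D (?G j))"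
      using J K disj by (intro prod.union_disjoint) auto
    also have "(\<Prod>j\<in>J. measure D (?G j)) = (\<Prod>j\<in>J. measure D (E j))"
      by simp
    also have "(\<Prod>j\<in>?K. measure D (?G j)) = (\<Prod>j\<in>?K. measure D (F (j - int n)))"
      by (rule prod.cong[OF refl]) (metis disj disjoint_iff)
    also have "\<dots> = (\<Prod>k\<in>K. measure D (F k))"
      by (simp add: prod.reindex)
    finally show ?thesis
      using J K by (simp add: A B \<nu>_def measure_PiM_emb)
  qed
  moreover have "\<forall>\<^sub>F n in sequentially. \<forall>j\<in>J. \<forall>k\<in>K. j \<noteq> k + int n"
    using J(1) K(1)
  proof (intro eventually_ball_finite ballI)
    fix j k show "\<forall>\<^sub>F n in sequentially. j \<noteq> k + int n"
      using eventually_gt_at_top[of "nat (j - k)"] by eventually_elim auto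
  qed
  ultimately have "\<forall>\<^sub>F n in sequentially. \<nu> (A \<inter> shift_vimage n B) = \<nu> A * \<nu> B"
    by (auto elim: eventually_mono)
  then show ?thesis
    by (rule tendsto_eventually)
qed

lemma shift_vimage_sets:
  assumes "B \<in> sets (PiM UNIV (\<lambda>_. D))"
  shows "shift_vimage n B \<in> sets (PiM UNIV (\<lambda>_. D))"
  unfolding shift_vimage_def using assms by (rule measurable_sets[OF measurable_PiM_shift])

lemma measure_shift_vimage:
  assumes "B \<in> sets (PiM UNIV (\<lambda>_. D))"
  shows "measure (PiM UNIV (\<lambda>_. D)) (shift_vimage n B) = measure (PiM UNIV (\<lambda>_. D)) B"
  using measure_distr[OF measurable_PiM_shift assms, of "int n"]
  by (simp add: distr_PiM_shift shift_vimage_def)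

text \<open>First of two Dynkin inductions: \<open>B\<close> stays a cylinder, while the events
  \<open>A\<close> for which the limit holds contain the cylinders and are closed under complements
  and countable disjoint unions.\<close>

lemma shift_mixing_right_cylinder:
  assumes "A \<in> sets (PiM UNIV (\<lambda>_::int. D))" and B: "B \<in> prod_algebra UNIV (\<lambda>_. D)"
  defines "\<nu> \<equiv> measure (PiM UNIV (\<lambda>_::int. D))"
  shows "(\<lambda>n. \<nu> (A \<inter> shift_vimage n B)) \<longlonglongrightarrow> \<nu> A * \<nu> B"
proof -
  interpret prob_space "PiM UNIV (\<lambda>_::int. D)"
    using D by (intro prob_space_PiM)
  have [measurable]: "B \<in> sets (PiM UNIV (\<lambda>_. D))"
    using B unfolding sets_PiM by blast
  note [measurable] = shift_vimage_sets
  show ?thesis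
    using Int_stable_prod_algebra prod_algebra_sets_into_space assms(1)[unfolded sets_PiM]
  proof (induction A rule: sigma_sets_induct_disjoint)
    case (basic A)
    then show ?case
      unfolding \<nu>_def using B by (rule shift_mixing_cylinders)
  next
    case (compl A)
    then have [measurable]: "A \<in> sets (PiM UNIV (\<lambda>_. D))"
      by (simp add: sets_PiM)
    have "(space (PiM UNIV (\<lambda>_. D)) - A) \<inter> shift_vimage n B = shift_vimage n B - A \<inter> shift_vimage n B" for n
      by (auto simp: shift_vimage_def)
    then have "\<nu> ((space (PiM UNIV (\<lambda>_. D)) - A) \<inter> shift_vimage n B) = \<nu> B - \<nu> (A \<inter> shift_vimage n B)" for n
      by (simp add: \<nu>_def finite_measure_Diff measure_shift_vimage)
    moreover have "(\<lambda>n. \<nu> B - \<nu> (A \<inter> shift_vimage n B)) \<longlonglongrightarrow> \<nu> B - \<nu> A * \<nu> B"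
      by (intro tendsto_intros compl.IH)
    moreover have "\<nu> (space (PiM UNIV (\<lambda>_. D)) - A) = 1 - \<nu> A"
      by (simp add: \<nu>_def prob_compl)
    ultimately show ?case
      by (simp add: left_diff_distrib flip: space_PiM)
  next
    case (union A)
    then have [measurable]: "A i \<in> sets (PiM UNIV (\<lambda>_. D))" for i
      by (auto simp: sets_PiM)
    have sums: "(\<lambda>i. \<nu> (A i)) sums \<nu> (\<Union>i. A i)"
      using union(1,2) unfolding \<nu>_def by (intro finite_measure_UNION) (auto simp: sets_PiM)
    have "disjoint_family (\<lambda>i. A i \<inter> shift_vimage n B)" for n
      using union(1) by (auto simp: disjoint_family_on_def)
    moreover have "range (\<lambda>i. A i \<inter> shift_vimage n B) \<subseteq> events" for n
      by (rule image_subsetI) measurable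
    ultimately have "\<nu> ((\<Union>i. A i) \<inter> shift_vimage n B) = (\<Sum>i. \<nu> (A i \<inter> shift_vimage n B))" for n
      unfolding \<nu>_def using finite_measure_UNION[of "\<lambda>i. A i \<inter> shift_vimage n B"]
      by (simp add: sums_unique)
    moreover have "\<nu> (\<Union>i. A i) * \<nu> B = (\<Sum>i. \<nu> (A i) * \<nu> B)"
      using sums by (intro sums_unique sums_mult2)
    moreover have "\<nu> (A i \<inter> shift_vimage n B) \<le> \<nu> (A i)" for n i
      unfolding \<nu>_def by (intro finite_measure_mono) auto
    \<comment> \<open>Tannery's theorem exchanges limit and sum, with the summable majorant
      \<open>\<nu> (A i)\<close>, which does not depend on \<open>n\<close>.\<close>
    then have "(\<lambda>n. \<Sum>i. \<nu> (A i \<inter> shift_vimage n B)) \<longlonglongrightarrow> (\<Sum>i. \<nu> (A i) * \<nu> B)"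
      using tannerys_theorem[of "\<lambda>i n. \<nu> (A i \<inter> shift_vimage n B)" "\<lambda>i. \<nu> (A i) * \<nu> B" sequentially "\<lambda>i. \<nu> (A i)"]
        union.IH sums
      by (auto simp: sums_iff \<nu>_def intro!: always_eventually)
    ultimately show ?case
      by simp
  qed (simp add: \<nu>_def)
qed

text \<open>Second Dynkin induction, now in \<open>B\<close> with \<open>A\<close> an arbitrary
  event; the previous lemma is the base case.\<close>

lemma shift_mixing:
  assumes [measurable]: "A \<in> sets (PiM UNIV (\<lambda>_::int. D))" and "B \<in> sets (PiM UNIV (\<lambda>_. D))"
  defines "\<nu> \<equiv> measure (PiM UNIV (\<lambda>_::int. D))"
  shows "(\<lambda>n. \<nu> (A \<inter> shift_vimage n B)) \<longlonglongrightarrow> \<nu> A * \<nu> B"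
proof -
  interpret prob_space "PiM UNIV (\<lambda>_::int. D)"
    using D by (intro prob_space_PiM)
  note [measurable] = shift_vimage_sets
  show ?thesis
    using Int_stable_prod_algebra prod_algebra_sets_into_space assms(2)[unfolded sets_PiM]
  proof (induction B rule: sigma_sets_induct_disjoint)
    case (basic B)
    then show ?case
      unfolding \<nu>_def by (intro shift_mixing_right_cylinder) auto
  next
    case (compl B)
    then have [measurable]: "B \<in> sets (PiM UNIV (\<lambda>_. D))"
      by (simp add: sets_PiM)
    have "A \<inter> shift_vimage n (space (PiM UNIV (\<lambda>_. D)) - B) = A - A \<inter> shift_vimage n B" for n
      using sets.sets_into_space[OF assms(1)]
      by (auto simp: shift_vimage_def space_PiM PiE_iff)
    then have "\<nu> (A \<inter> shift_vimage n (space (PiM UNIV (\<lambda>_. D)) - B)) = \<nu> A - \<nu> (A \<inter> shift_vimage n B)" for n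
      by (simp add: \<nu>_def finite_measure_Diff)
    moreover have "(\<lambda>n. \<nu> A - \<nu> (A \<inter> shift_vimage n B)) \<longlonglongrightarrow> \<nu> A - \<nu> A * \<nu> B"
      by (intro tendsto_intros compl.IH)
    moreover have "\<nu> (space (PiM UNIV (\<lambda>_. D)) - B) = 1 - \<nu> B"
      by (simp add: \<nu>_def prob_compl)
    ultimately show ?case
      by (simp add: right_diff_distrib flip: space_PiM)
  next
    case (union B)
    then have [measurable]: "B i \<in> sets (PiM UNIV (\<lambda>_. D))" for i
      by (auto simp: sets_PiM)
    have sums: "(\<lambda>i. \<nu> (B i)) sums \<nu> (\<Union>i. B i)"
      using union(1,2) unfolding \<nu>_def by (intro finite_measure_UNION) (auto simp: sets_PiM)
    have "A \<inter> shift_vimage n (\<Union>i. B i) = (\<Union>i. A \<inter> shift_vimage n (B i))" for n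
      by (auto simp: shift_vimage_def)
    moreover have "disjoint_family (\<lambda>i. A \<inter> shift_vimage n (B i))" for n
      using union(1) by (auto simp: disjoint_family_on_def shift_vimage_def)
    moreover have "range (\<lambda>i. A \<inter> shift_vimage n (B i)) \<subseteq> events" for n
      by (rule image_subsetI) measurable
    ultimately have "\<nu> (A \<inter> shift_vimage n (\<Union>i. B i)) = (\<Sum>i. \<nu> (A \<inter> shift_vimage n (B i)))" for n
      unfolding \<nu>_def using finite_measure_UNION[of "\<lambda>i. A \<inter> shift_vimage n (B i)"]
      by (simp add: sums_unique)
    moreover have "\<nu> A * \<nu> (\<Union>i. B i) = (\<Sum>i. \<nu> A * \<nu> (B i))"
      using sums by (intro sums_unique sums_mult)
    \<comment> \<open>Shift invariance of the product measure is what gives a majorant independent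
      of \<open>n\<close> here.\<close>
    moreover have "\<nu> (A \<inter> shift_vimage n (B i)) \<le> \<nu> (B i)" for n i
      using finite_measure_mono[of "A \<inter> shift_vimage n (B i)" "shift_vimage n (B i)"]
      by (simp add: \<nu>_def measure_shift_vimage)
    then have "(\<lambda>n. \<Sum>i. \<nu> (A \<inter> shift_vimage n (B i))) \<longlonglongrightarrow> (\<Sum>i. \<nu> A * \<nu> (B i))"
      using tannerys_theorem[of "\<lambda>i n. \<nu> (A \<inter> shift_vimage n (B i))" "\<lambda>i. \<nu> A * \<nu> (B i)" sequentially "\<lambda>i. \<nu> (B i)"]
        union.IH sums
      by (auto simp: sums_iff \<nu>_def intro!: always_eventually)
    ultimately show ?case
      by simp
  qed (simp add: \<nu>_def shift_vimage_def)
qed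

text \<open>Mixing of \<open>A\<close> with itself makes the constant sequence
  \<open>\<nu> A\<close> converge to \<open>\<nu> A * \<nu> A\<close>, so the probability equals its
  own square.\<close>

lemma shift_invariant_trivial:
  assumes A: "A \<in> sets (PiM UNIV (\<lambda>_::int. D))" and inv: "shift_vimage 1 A = A"
  shows "measure (PiM UNIV (\<lambda>_. D)) A = 0 \<or> measure (PiM UNIV (\<lambda>_. D)) A = 1"
proof -
  have "shift_vimage n A = A" for n
  proof (induction n)
    case 0
    show ?case using sets.sets_into_space[OF A] by (auto simp: shift_vimage_def)
  next
    case (Suc n)
    have "shift_vimage (Suc n) A = shift_vimage n (shift_vimage 1 A)"
      by (auto simp: shift_vimage_def space_PiM PiE_iff ac_simps)
    then show ?case by (simp only: inv Suc)
  qed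
  then have "(\<lambda>n::nat. measure (PiM UNIV (\<lambda>_. D)) A) \<longlonglongrightarrow>
      measure (PiM UNIV (\<lambda>_. D)) A * measure (PiM UNIV (\<lambda>_. D)) A"
    using shift_mixing[OF A A] by simp
  then show ?thesis
    by (simp add: LIMSEQ_const_iff)
qed

end

section \<open>Functionals of independent identically distributed noise\<close>

text \<open>Independence turns the law of the noise path into the product of its marginals, and
  these all coincide. Results on the Bernoulli shift thus become available for the noise.\<close>

lemma (in prob_space) iid_distr_path:
  fixes \<epsilon> :: "int \<Rightarrow> 'a \<Rightarrow> real"
  assumes indep: "indep_vars (\<lambda>_. borel) \<epsilon> UNIV"
    and ident: "\<And>s t. distr M borel (\<epsilon> s) = distr M borel (\<epsilon> t)"
  shows "distr M (PiM UNIV (\<lambda>_. borel)) (\<lambda>\<omega> t. \<epsilon> t \<omega>) = PiM UNIV (\<lambda>_. distr M borel (\<epsilon> 0))"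
proof -
  have "distr M (PiM UNIV (\<lambda>_. borel)) (\<lambda>\<omega> t. \<epsilon> t \<omega>) = PiM UNIV (\<lambda>i. distr M borel (\<epsilon> i))"
    using indep_vars_iff_distr_eq_PiM[where I=UNIV and M'="\<lambda>_. borel" and X=\<epsilon>] indep
    by (simp add: restrict_UNIV indep_vars_def)
  also have "(\<lambda>i. distr M borel (\<epsilon> i)) = (\<lambda>_. distr M borel (\<epsilon> 0))"
    using ident by blast
  finally show ?thesis .
qed

lemma measurable_path:
  assumes "\<And>t. \<epsilon> t \<in> borel_measurable M"
  shows "(\<lambda>\<omega> t. \<epsilon> t \<omega>) \<in> measurable M (PiM UNIV (\<lambda>_::int. borel))"
  using assms by (intro measurable_PiM_single') (auto simp: space_PiM PiE_iff)

context prob_space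
begin

context
  fixes \<epsilon> :: "int \<Rightarrow> 'a \<Rightarrow> real" and G :: "(int \<Rightarrow> real) \<Rightarrow> real"
  assumes indep: "indep_vars (\<lambda>_. borel) \<epsilon> UNIV"
    and ident: "\<And>s t. distr M borel (\<epsilon> s) = distr M borel (\<epsilon> t)"
    and G: "G \<in> borel_measurable (PiM UNIV (\<lambda>_. borel))"
begin

text \<open>Shifting the process amounts to shifting the noise path before the same functional is
  applied, and the product law is invariant under shifts.\<close>

lemma stationary_iid_factor:
  "strictly_stationary M (\<lambda>t \<omega>. G (\<lambda>k. \<epsilon> (t + k) \<omega>))"
  unfolding strictly_stationary_def
proof (intro conjI allI impI)
  let ?P = "PiM UNIV (\<lambda>_::int. borel :: real measure)"
  have \<epsilon>: "\<epsilon> t \<in> borel_measurable M" for t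
    using indep by (simp add: indep_vars_def)
  show "(\<lambda>\<omega>. G (\<lambda>k. \<epsilon> (t + k) \<omega>)) \<in> borel_measurable M" for t
    by (rule measurable_compose[OF measurable_path G]) (rule \<epsilon>)
  fix J :: "int set" and h :: int
  let ?Q = "PiM J (\<lambda>_. borel :: real measure)"
  define \<Psi> where "\<Psi> x = (\<lambda>t\<in>J. G (\<lambda>k. x (t + k)))" for x :: "int \<Rightarrow> real"
  have shift: "(\<lambda>x t. x (t + h)) \<in> measurable ?P ?P" for h
    by (intro measurable_path) auto
  have \<Psi>: "\<Psi> \<in> measurable ?P ?Q"
    unfolding \<Psi>_def
    by (intro measurable_restrict measurable_compose[OF measurable_path G]) auto
  have "distr M ?Q (\<lambda>\<omega>. \<lambda>t\<in>J. G (\<lambda>k. \<epsilon> (t + h + k) \<omega>)) =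
      distr (distr (distr M ?P (\<lambda>\<omega> t. \<epsilon> t \<omega>)) ?P (\<lambda>x t. x (t + h))) ?Q \<Psi>"
    using measurable_path[OF \<epsilon>] shift \<Psi>
    by (simp add: distr_distr[where N="?P"] measurable_comp[where N="?P"]) (simp add: comp_def \<Psi>_def ac_simps)
  also have "distr (distr M ?P (\<lambda>\<omega> t. \<epsilon> t \<omega>)) ?P (\<lambda>x t. x (t + h)) = distr M ?P (\<lambda>\<omega> t. \<epsilon> t \<omega>)"
  proof -
    let ?D = "distr M borel (\<epsilon> 0)"
    \<comment> \<open>The target of \<open>distr\<close> matters only through its sets, and these
      agree for powers of \<open>?D\<close> and of \<open>borel\<close>.\<close>
    have "distr (PiM UNIV (\<lambda>_. ?D)) ?P (\<lambda>x t. x (t + h)) =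
        distr (PiM UNIV (\<lambda>_. ?D)) (PiM UNIV (\<lambda>_. ?D)) (\<lambda>x t. x (t + h))"
      by (intro distr_cong) (auto intro!: sets_PiM_cong)
    then show ?thesis
      using distr_PiM_shift[of ?D h] prob_space_distr[OF \<epsilon>[of 0]]
      by (simp add: iid_distr_path[OF indep ident])
  qed
  also have "distr (distr M ?P (\<lambda>\<omega> t. \<epsilon> t \<omega>)) ?Q \<Psi> = distr M ?Q (\<lambda>\<omega>. \<lambda>t\<in>J. G (\<lambda>k. \<epsilon> (t + k) \<omega>))"
    using measurable_path[OF \<epsilon>] \<Psi> by (simp add: distr_distr comp_def \<Psi>_def)
  finally show "distr M ?Q (\<lambda>\<omega>. \<lambda>t\<in>J. G (\<lambda>k. \<epsilon> (t + h + k) \<omega>)) =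
      distr M ?Q (\<lambda>\<omega>. \<lambda>t\<in>J. G (\<lambda>k. \<epsilon> (t + k) \<omega>))" .
qed

text \<open>The map from noise paths to process paths commutes with the shift. It pulls an invariant
  set back to an invariant event of the Bernoulli shift, which is trivial.\<close>

lemma ergodic_iid_factor:
  "ergodic_process M (\<lambda>t \<omega>. G (\<lambda>k. \<epsilon> (t + k) \<omega>))"
  unfolding ergodic_process_def
proof (intro conjI ballI impI stationary_iid_factor)
  let ?P = "PiM UNIV (\<lambda>_::int. borel :: real measure)"
  let ?D = "distr M borel (\<epsilon> 0)"
  have \<epsilon>: "\<epsilon> t \<in> borel_measurable M" for t
    using indep by (simp add: indep_vars_def)
  fix A assume A: "A \<in> sets ?P" and inv: "path_shift -` A = A"
  define \<Phi> where "\<Phi> x = (\<lambda>t. G (\<lambda>k. x (t + k)))" for x :: "int \<Rightarrow> real"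
  have \<Phi>: "\<Phi> \<in> measurable ?P ?P"
    unfolding \<Phi>_def
    by (intro measurable_path measurable_compose[OF measurable_path G]) auto
  have "path_law M (\<lambda>t \<omega>. G (\<lambda>k. \<epsilon> (t + k) \<omega>)) = distr (distr M ?P (\<lambda>\<omega> t. \<epsilon> t \<omega>)) ?P \<Phi>"
    using measurable_path[OF \<epsilon>] \<Phi> by (simp add: path_law_def distr_distr comp_def \<Phi>_def)
  also have "\<dots> = distr (PiM UNIV (\<lambda>_. ?D)) ?P \<Phi>"
    by (simp add: iid_distr_path[OF indep ident])
  finally have law: "path_law M (\<lambda>t \<omega>. G (\<lambda>k. \<epsilon> (t + k) \<omega>)) = distr (PiM UNIV (\<lambda>_. ?D)) ?P \<Phi>" .
  have sets: "sets (PiM UNIV (\<lambda>_. ?D)) = sets ?P"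
    by (intro sets_PiM_cong) auto
  have \<Phi>': "\<Phi> \<in> measurable (PiM UNIV (\<lambda>_. ?D)) ?P"
    using \<Phi> by (simp add: measurable_cong_sets[OF sets refl])
  have "\<Phi> (\<lambda>t. x (t + 1)) = path_shift (\<Phi> x)" for x
    by (simp add: \<Phi>_def path_shift_def ac_simps)
  then have "\<Phi> (\<lambda>t. x (t + 1)) \<in> A \<longleftrightarrow> \<Phi> x \<in> A" for x
    using inv by (metis vimage_eq)
  then have "shift_vimage ?D 1 (\<Phi> -` A) = \<Phi> -` A"
    by (auto simp: shift_vimage_def[OF prob_space_distr[OF \<epsilon>]] space_PiM)
  moreover have "\<Phi> -` A \<in> sets (PiM UNIV (\<lambda>_. ?D))"
    using measurable_sets[OF \<Phi>' A] by (simp add: space_PiM)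
  ultimately have "measure (PiM UNIV (\<lambda>_. ?D)) (\<Phi> -` A) = 0 \<or> measure (PiM UNIV (\<lambda>_. ?D)) (\<Phi> -` A) = 1"
    using shift_invariant_trivial[OF prob_space_distr[OF \<epsilon>]] by blast
  then show "measure (path_law M (\<lambda>t \<omega>. G (\<lambda>k. \<epsilon> (t + k) \<omega>))) A = 0 \<or>
      measure (path_law M (\<lambda>t \<omega>. G (\<lambda>k. \<epsilon> (t + k) \<omega>))) A = 1"
    unfolding law using measure_distr[OF \<Phi>' A] by (simp add: space_PiM)
qed

end
end

section \<open>The bilinear recursion\<close>

text \<open>Continuity from above: the tail events decrease to the empty set because
  \<open>X\<close> is real-valued. Taking levels \<open>Suc n\<close> keeps \<open>K\<close>
  positive.\<close>

lemma (in prob_space) exists_tail_prob_less: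
  fixes X :: "'a \<Rightarrow> real"
  assumes [measurable]: "X \<in> borel_measurable M" and "0 < e"
  shows "\<exists>K>0. prob {\<omega> \<in> space M. K < \<bar>X \<omega>\<bar>} < e"
proof -
  let ?A = "\<lambda>n. {\<omega> \<in> space M. real (Suc n) < \<bar>X \<omega>\<bar>}"
  have "(\<Inter>n. ?A n) = {}"
  proof -
    have "\<exists>n. \<not> real (Suc n) < \<bar>X \<omega>\<bar>" for \<omega>
    proof -
      obtain n where "\<bar>X \<omega>\<bar> \<le> real n"
        using real_arch_simple by blast
      then have "\<not> real (Suc n) < \<bar>X \<omega>\<bar>" by simp
      then show ?thesis by blast
    qed
    then show ?thesis by blast
  qed
  moreover have "(\<lambda>n. prob (?A n)) \<longlonglongrightarrow> prob (\<Inter>n. ?A n)"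
    by (rule finite_Lim_measure_decseq) (auto simp: decseq_def)
  ultimately have "(\<lambda>n. prob (?A n)) \<longlonglongrightarrow> 0"
    by simp
  then obtain n where "prob (?A n) < e"
    using order_tendstoD(2)[OF _ assms(2)] eventually_happens'[OF sequentially_bot] by blast
  then show ?thesis
    by (intro exI[of _ "real (Suc n)"]) auto
qed

text \<open>The index set \<open>{0}\<close> in the definition of stationarity, followed by
  projection to its only coordinate, compares every marginal with the one at time 0.\<close>

lemma strictly_stationary_distr_eq:
  assumes "strictly_stationary M Y"
  shows "distr M borel (Y s) = distr M borel (Y t)"
proof -
  have [measurable]: "Y t \<in> borel_measurable M" for t
    using assms by (simp add: strictly_stationary_def)
  have "distr M borel (Y (0 + h)) = distr M borel (Y 0)" for h
  proof -
    let ?Q = "PiM {0::int} (\<lambda>_. borel :: real measure)"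
    have "distr (distr M ?Q (\<lambda>\<omega>. \<lambda>t\<in>{0}. Y (t + h) \<omega>)) borel (\<lambda>x. x 0) =
        distr (distr M ?Q (\<lambda>\<omega>. \<lambda>t\<in>{0}. Y t \<omega>)) borel (\<lambda>x. x 0)"
      using assms unfolding strictly_stationary_def by (metis finite.emptyI finite.insertI)
    moreover have "(\<lambda>\<omega>. \<lambda>t\<in>{0}. Y (t + h) \<omega>) \<in> measurable M ?Q" for h
      by measurable
    moreover have "(\<lambda>x. x 0) \<in> measurable ?Q borel"
      by measurable
    ultimately show ?thesis
      using \<open>\<And>h. (\<lambda>\<omega>. \<lambda>t\<in>{0}. Y (t + h) \<omega>) \<in> measurable M ?Q\<close>[of 0]
      by (simp add: distr_distr comp_def)
  qed
  from this[of s] this[of t] show ?thesis by simp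
qed

section \<open>Moments of coefficient products, convergence of the series and uniqueness\<close>

context prob_space
begin

context
  fixes \<epsilon> :: "int \<Rightarrow> 'a \<Rightarrow> real" and \<phi> b s :: real
  assumes indep: "indep_vars (\<lambda>_. borel) \<epsilon> UNIV"
    and ident: "\<And>s t. distr M borel (\<epsilon> s) = distr M borel (\<epsilon> t)"
    and integrable: "integrable M (\<epsilon> 0)"
    and s: "0 < s" "s \<le> 1"
    and contraction: "expectation (\<lambda>\<omega>. \<bar>\<phi> + b * \<epsilon> 0 \<omega>\<bar> powr s) < 1"
begin

lemma noise_measurable [measurable]: "\<epsilon> t \<in> borel_measurable M"
  using indep by (simp add: indep_vars_def)

lemma integrable_powr_affine: "integrable M (\<lambda>\<omega>. \<bar>c + d * \<epsilon> 0 \<omega>\<bar> powr s)"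
  using integrable s by (intro integrable_powr_le_one) auto

text \<open>The noise variables occur at pairwise distinct times, so the expectation factorizes. The
  free last factor \<open>h\<close> serves both the summands of the series
  (\<open>h x = \<mu> + x\<close>) and the bare product (\<open>h = 1\<close>).\<close>

lemma nn_integral_product_powr:
  assumes [measurable]: "h \<in> borel_measurable borel"
  shows "(\<integral>\<^sup>+\<omega>. \<bar>(\<Prod>r<n. \<phi> + b * \<epsilon> (t - 2 * int r - 1) \<omega>) * h (\<epsilon> (t - 2 * int n) \<omega>)\<bar> powr s \<partial>M) =
    ennreal (expectation (\<lambda>\<omega>. \<bar>\<phi> + b * \<epsilon> 0 \<omega>\<bar> powr s)) ^ n * (\<integral>\<^sup>+\<omega>. \<bar>h (\<epsilon> 0 \<omega>)\<bar> powr s \<partial>M)"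
proof -
  let ?m = "t - 2 * int n" and ?g = "\<lambda>r. t - 2 * int r - 1"
  \<comment> \<open>Attaches to each time the factor that its noise variable contributes, so that
    independence can be applied to one product over a set of times.\<close>
  define f where "f k x = (if k = ?m then \<bar>h x\<bar> powr s else \<bar>\<phi> + b * x\<bar> powr s)" for k x
  have [measurable]: "f k \<in> borel_measurable borel" for k
    unfolding f_def by (cases "k = ?m") auto
  \<comment> \<open>By parity: the times of the coefficients differ from \<open>t\<close> by odd
    numbers, the time of the last factor by an even one.\<close>
  have m: "?m \<notin> ?g ` {..<n}"
  proof -
    have "?m \<noteq> ?g r" for r
      by presburger
    then show ?thesis by blast
  qed
  have inj: "inj_on ?g {..<n}"
    by (auto simp: inj_on_def)
  have f: "(\<integral>\<^sup>+\<omega>. f k (\<epsilon> j \<omega>) \<partial>M) = (\<integral>\<^sup>+\<omega>. f k (\<epsilon> 0 \<omega>) \<partial>M)" for j k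
    using nn_integral_distr[of "\<epsilon> j" M borel "\<lambda>x. ennreal (f k x)"]
      nn_integral_distr[of "\<epsilon> 0" M borel "\<lambda>x. ennreal (f k x)"] ident[of j 0]
    by simp
  have "(\<integral>\<^sup>+\<omega>. (\<Prod>k\<in>insert ?m (?g ` {..<n}). ennreal (f k (\<epsilon> k \<omega>))) \<partial>M) =
      (\<Prod>k\<in>insert ?m (?g ` {..<n}). \<integral>\<^sup>+\<omega>. f k (\<epsilon> k \<omega>) \<partial>M)"
  proof (rule indep_vars_nn_integral)
    show "indep_vars (\<lambda>_. borel) (\<lambda>k \<omega>. ennreal (f k (\<epsilon> k \<omega>))) (insert ?m (?g ` {..<n}))"
      by (rule indep_vars_subset[OF indep_vars_compose2[OF indep]]) auto
  qed auto
  also have "\<dots> = (\<Prod>k\<in>insert ?m (?g ` {..<n}). \<integral>\<^sup>+\<omega>. f k (\<epsilon> 0 \<omega>) \<partial>M)"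
    by (intro prod.cong refl f)
  also have "\<dots> = (\<integral>\<^sup>+\<omega>. f ?m (\<epsilon> 0 \<omega>) \<partial>M) * (\<Prod>r<n. \<integral>\<^sup>+\<omega>. f (?g r) (\<epsilon> 0 \<omega>) \<partial>M)"
    using m inj by (simp add: prod.reindex)
  also have "(\<Prod>r<n. \<integral>\<^sup>+\<omega>. f (?g r) (\<epsilon> 0 \<omega>) \<partial>M) = (\<Prod>r<n. \<integral>\<^sup>+\<omega>. \<bar>\<phi> + b * \<epsilon> 0 \<omega>\<bar> powr s \<partial>M)"
    using m by (intro prod.cong) (auto simp: f_def)
  also have "\<dots> = ennreal (expectation (\<lambda>\<omega>. \<bar>\<phi> + b * \<epsilon> 0 \<omega>\<bar> powr s)) ^ n"
    by (simp add: nn_integral_eq_integral integrable_powr_affine)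
  also have "(\<integral>\<^sup>+\<omega>. f ?m (\<epsilon> 0 \<omega>) \<partial>M) = (\<integral>\<^sup>+\<omega>. \<bar>h (\<epsilon> 0 \<omega>)\<bar> powr s \<partial>M)"
    by (simp add: f_def)
  also have "(\<lambda>\<omega>. \<Prod>k\<in>insert ?m (?g ` {..<n}). ennreal (f k (\<epsilon> k \<omega>))) =
      (\<lambda>\<omega>. ennreal (\<bar>(\<Prod>r<n. \<phi> + b * \<epsilon> (?g r) \<omega>) * h (\<epsilon> ?m \<omega>)\<bar> powr s))"
  proof
    fix \<omega>
    have "(\<Prod>k\<in>insert ?m (?g ` {..<n}). f k (\<epsilon> k \<omega>)) = f ?m (\<epsilon> ?m \<omega>) * (\<Prod>r<n. f (?g r) (\<epsilon> (?g r) \<omega>))"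
      using m inj by (simp add: prod.reindex)
    also have "(\<Prod>r<n. f (?g r) (\<epsilon> (?g r) \<omega>)) = (\<Prod>r<n. \<bar>\<phi> + b * \<epsilon> (?g r) \<omega>\<bar> powr s)"
      using m by (intro prod.cong) (auto simp: f_def)
    finally have "(\<Prod>k\<in>insert ?m (?g ` {..<n}). f k (\<epsilon> k \<omega>)) =
        \<bar>(\<Prod>r<n. \<phi> + b * \<epsilon> (?g r) \<omega>) * h (\<epsilon> ?m \<omega>)\<bar> powr s"
      by (simp add: f_def abs_mult abs_prod powr_mult prod_powr_distrib prod_nonneg)
    then show "(\<Prod>k\<in>insert ?m (?g ` {..<n}). ennreal (f k (\<epsilon> k \<omega>))) =
        ennreal (\<bar>(\<Prod>r<n. \<phi> + b * \<epsilon> (?g r) \<omega>) * h (\<epsilon> ?m \<omega>)\<bar> powr s)"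
      by (subst prod_ennreal) (auto simp: f_def)
  qed
  finally show ?thesis
    by (simp add: mult.commute)
qed

text \<open>The expected sum of \<open>s\<close>-th powers is a convergent geometric series, so that
  sum is finite almost surely. The index starts at 0 here, which adds the summand
  \<open>\<mu> + \<epsilon> t\<close> to the series of the theorem.\<close>

lemma AE_summable_series_term:
  "AE \<omega> in M. summable (\<lambda>i. series_term \<epsilon> \<mu> \<phi> b t \<omega> i)"
proof -
  let ?\<rho> = "expectation (\<lambda>\<omega>. \<bar>\<phi> + b * \<epsilon> 0 \<omega>\<bar> powr s)"
  let ?C = "expectation (\<lambda>\<omega>. \<bar>\<mu> + 1 * \<epsilon> 0 \<omega>\<bar> powr s)"
  have [measurable]: "(\<lambda>\<omega>. series_term \<epsilon> \<mu> \<phi> b t \<omega> i) \<in> borel_measurable M" for i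
    unfolding series_term_def by measurable
  have "(\<integral>\<^sup>+\<omega>. \<bar>series_term \<epsilon> \<mu> \<phi> b t \<omega> i\<bar> powr s \<partial>M) = ennreal (?\<rho> ^ i * ?C)" for i
    unfolding series_term_def using integrable_powr_affine[of \<mu> 1]
    by (subst nn_integral_product_powr)
      (simp_all add: nn_integral_eq_integral ennreal_mult' ennreal_power)
  then have "(\<integral>\<^sup>+\<omega>. (\<Sum>i. ennreal (\<bar>series_term \<epsilon> \<mu> \<phi> b t \<omega> i\<bar> powr s)) \<partial>M) = (\<Sum>i. ennreal (?\<rho> ^ i * ?C))"
    by (subst nn_integral_suminf) auto
  also have "\<dots> \<noteq> top"
    using contraction by (intro ennreal_suminf_neq_top summable_mult2 summable_geometric) auto
  finally have "AE \<omega> in M. (\<Sum>i. ennreal (\<bar>series_term \<epsilon> \<mu> \<phi> b t \<omega> i\<bar> powr s)) \<noteq> \<infinity>"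
    by (intro nn_integral_PInf_AE) auto
  then show ?thesis
  proof eventually_elim
    case (elim \<omega>)
    then have sum: "summable (\<lambda>i. \<bar>series_term \<epsilon> \<mu> \<phi> b t \<omega> i\<bar> powr s)"
      by (intro summable_suminf_not_top) auto
    have "\<forall>\<^sub>F i in sequentially. \<bar>series_term \<epsilon> \<mu> \<phi> b t \<omega> i\<bar> powr s < 1"
      using summable_LIMSEQ_zero[OF sum] by (rule order_tendstoD) simp
    \<comment> \<open>Eventually the terms are at most 1 in absolute value, and there lowering the
      exponent from 1 to \<open>s\<close> can only increase the power.\<close>
    then have "\<forall>\<^sub>F i in sequentially.
        norm (series_term \<epsilon> \<mu> \<phi> b t \<omega> i) \<le> \<bar>series_term \<epsilon> \<mu> \<phi> b t \<omega> i\<bar> powr s"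
    proof eventually_elim
      case (elim i)
      let ?x = "\<bar>series_term \<epsilon> \<mu> \<phi> b t \<omega> i\<bar>"
      have "?x \<le> 1"
        using elim s ge_one_powr_ge_zero[of ?x s] by (cases "?x \<le> 1") auto
      then have "?x powr 1 \<le> ?x powr s"
        using s by (intro powr_mono') auto
      then show ?case by simp
    qed
    then show ?case
      using sum by (rule summable_comparison_test_ev)
  qed
qed

text \<open>Markov's inequality for the \<open>s\<close>-th power bounds the probability by
  \<open>?\<rho> ^ n / c powr s\<close>, which decays geometrically.\<close>

lemma prob_product_tendsto_zero:
  assumes "0 < c"
  shows "(\<lambda>n. prob {\<omega> \<in> space M. c < \<bar>\<Prod>r<n. \<phi> + b * \<epsilon> (t - 2 * int r - 1) \<omega>\<bar>}) \<longlonglongrightarrow> 0"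
proof -
  let ?\<rho> = "expectation (\<lambda>\<omega>. \<bar>\<phi> + b * \<epsilon> 0 \<omega>\<bar> powr s)"
  let ?P = "\<lambda>n \<omega>. \<bar>\<Prod>r<n. \<phi> + b * \<epsilon> (t - 2 * int r - 1) \<omega>\<bar>"
  have nn: "(\<integral>\<^sup>+\<omega>. ?P n \<omega> powr s \<partial>M) = ennreal (?\<rho> ^ n)" for n
    using nn_integral_product_powr[of "\<lambda>_. 1" t n] by (simp add: emeasure_space_1 ennreal_power)
  have int: "integrable M (\<lambda>\<omega>. ?P n \<omega> powr s)" for n
    using nn[of n] by (intro integrableI_nonneg) auto
  have E: "expectation (\<lambda>\<omega>. ?P n \<omega> powr s) = ?\<rho> ^ n" for n
    using nn[of n] by (simp add: nn_integral_eq_integral[OF int])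
  have "prob {\<omega> \<in> space M. c < ?P n \<omega>} \<le> ?\<rho> ^ n / c powr s" for n
  proof -
    have "prob {\<omega> \<in> space M. c < ?P n \<omega>} \<le> prob {\<omega> \<in> space M. c powr s \<le> ?P n \<omega> powr s}"
      using s assms by (intro finite_measure_mono) (auto intro!: powr_mono2)
    also have "\<dots> \<le> expectation (\<lambda>\<omega>. ?P n \<omega> powr s) / c powr s"
      using assms int by (intro integral_Markov_inequality_measure[where A="space M"]) auto
    finally show ?thesis by (simp add: E)
  qed
  moreover have "(\<lambda>n. ?\<rho> ^ n / c powr s) \<longlonglongrightarrow> 0 / c powr s"
    using contraction by (intro tendsto_divide LIMSEQ_realpow_zero tendsto_const) (use assms in auto)
  ultimately show ?thesis
    by (auto intro!: always_eventually tendsto_sandwich[OF _ _ tendsto_const[of 0], where h="\<lambda>n. ?\<rho> ^ n / c powr s"])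
qed

text \<open>The noise terms cancel in the difference of two solutions, which leaves a homogeneous
  linear recursion that can be iterated backwards in time.\<close>

lemma stationary_solution_unique:
  assumes Y: "strictly_stationary M Y" "bilinear_solution M \<epsilon> \<mu> \<phi> b Y"
    and Z: "strictly_stationary M Z" "bilinear_solution M \<epsilon> \<mu> \<phi> b Z"
  shows "AE \<omega> in M. Z t \<omega> = Y t \<omega>"
proof -
  have [measurable]: "Y t \<in> borel_measurable M" "Z t \<in> borel_measurable M" for t
    using Y(1) Z(1) by (auto simp: strictly_stationary_def)
  have step: "AE \<omega> in M. Z t \<omega> - Y t \<omega> = (\<phi> + b * \<epsilon> (t - 1) \<omega>) * (Z (t - 2) \<omega> - Y (t - 2) \<omega>)" for t
  proof -
    have "AE \<omega> in M. Y t \<omega> = \<mu> + \<phi> * Y (t - 2) \<omega> + b * Y (t - 2) \<omega> * \<epsilon> (t - 1) \<omega> + \<epsilon> t \<omega>"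
      "AE \<omega> in M. Z t \<omega> = \<mu> + \<phi> * Z (t - 2) \<omega> + b * Z (t - 2) \<omega> * \<epsilon> (t - 1) \<omega> + \<epsilon> t \<omega>"
      using Y(2) Z(2) by (auto simp: bilinear_solution_def)
    then show ?thesis
      by eventually_elim (simp add: algebra_simps)
  qed
  have iter: "AE \<omega> in M. Z t \<omega> - Y t \<omega> =
      (\<Prod>r<n. \<phi> + b * \<epsilon> (t - 2 * int r - 1) \<omega>) * (Z (t - 2 * int n) \<omega> - Y (t - 2 * int n) \<omega>)" for n
  proof (induction n)
    case (Suc n)
    have index: "t - 2 * int n - 2 = t - 2 * int (Suc n)"
      by simp
    from Suc step[of "t - 2 * int n"] show ?case
      by eventually_elim (simp only: index prod.lessThan_Suc mult.assoc)
  qed simp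
  \<comment> \<open>This is the use of stationarity: tail bounds chosen at time \<open>t\<close>
    hold at all times \<open>t - 2 * int n\<close>, so the levels below do not depend on
    \<open>n\<close>.\<close>
  have tail: "prob {\<omega> \<in> space M. K < \<bar>X r \<omega>\<bar>} = prob {\<omega> \<in> space M. K < \<bar>X t \<omega>\<bar>}"
    if "strictly_stationary M X" for X r K
  proof -
    have [measurable]: "X t \<in> borel_measurable M" for t
      using that by (simp add: strictly_stationary_def)
    have "prob {\<omega> \<in> space M. K < \<bar>X u \<omega>\<bar>} = measure (distr M borel (X u)) {x. K < \<bar>x\<bar>}" for u
      by (subst measure_distr) (auto intro!: arg_cong[where f=prob])
    then show ?thesis
      using strictly_stationary_distr_eq[OF that, of r t] by simp
  qed
  have "AE \<omega> in M. \<bar>Z t \<omega> - Y t \<omega>\<bar> \<le> \<delta>" if "0 < \<delta>" for \<delta>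
  proof -
    let ?D = "{\<omega> \<in> space M. \<delta> < \<bar>Z t \<omega> - Y t \<omega>\<bar>}"
    have "prob ?D \<le> 0 + e" if "0 < e" for e
    proof -
      obtain K\<^sub>Y where KY: "0 < K\<^sub>Y" "prob {\<omega> \<in> space M. K\<^sub>Y < \<bar>Y t \<omega>\<bar>} < e / 2"
        using exists_tail_prob_less[of "Y t" "e / 2"] \<open>0 < e\<close> by auto
      obtain K\<^sub>Z where KZ: "0 < K\<^sub>Z" "prob {\<omega> \<in> space M. K\<^sub>Z < \<bar>Z t \<omega>\<bar>} < e / 2"
        using exists_tail_prob_less[of "Z t" "e / 2"] \<open>0 < e\<close> by auto
      \<comment> \<open>Chosen so that a product of size at most \<open>?c\<close> times a
        difference of size at most \<open>K\<^sub>Y + K\<^sub>Z\<close> does not exceed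
        \<open>\<delta>\<close>.\<close>
      let ?c = "\<delta> / (K\<^sub>Y + K\<^sub>Z)"
      have c: "0 < ?c" using \<open>0 < \<delta>\<close> KY KZ by simp
      let ?P = "\<lambda>n. {\<omega> \<in> space M. ?c < \<bar>\<Prod>r<n. \<phi> + b * \<epsilon> (t - 2 * int r - 1) \<omega>\<bar>}"
      have "prob ?D \<le> prob (?P n) + e" for n
      proof -
        let ?u = "t - 2 * int n"
        let ?A = "{\<omega> \<in> space M. K\<^sub>Y < \<bar>Y ?u \<omega>\<bar>}" and ?B = "{\<omega> \<in> space M. K\<^sub>Z < \<bar>Z ?u \<omega>\<bar>}"
        have "prob ?D \<le> prob (?P n \<union> (?A \<union> ?B))"
        proof (rule finite_measure_mono_AE)
          show "AE \<omega> in M. \<omega> \<in> ?D \<longrightarrow> \<omega> \<in> ?P n \<union> (?A \<union> ?B)"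
            using iter[of n]
          proof eventually_elim
            case (elim \<omega>)
            let ?p = "\<Prod>r<n. \<phi> + b * \<epsilon> (t - 2 * int r - 1) \<omega>"
            have "\<not> \<delta> < \<bar>Z t \<omega> - Y t \<omega>\<bar>"
              if "\<not> ?c < \<bar>?p\<bar>" "\<not> K\<^sub>Y < \<bar>Y ?u \<omega>\<bar>" "\<not> K\<^sub>Z < \<bar>Z ?u \<omega>\<bar>"
            proof -
              have "\<bar>Z t \<omega> - Y t \<omega>\<bar> = \<bar>?p\<bar> * \<bar>Z ?u \<omega> - Y ?u \<omega>\<bar>"
                by (simp add: elim abs_mult)
              also have "\<dots> \<le> ?c * (K\<^sub>Y + K\<^sub>Z)"
                using that c by (intro mult_mono) auto
              also have "\<dots> = \<delta>"
                using KY KZ by simp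
              finally show ?thesis by (simp add: not_less)
            qed
            then show ?case
              by blast
          qed
        qed measurable
        also have "\<dots> \<le> prob (?P n) + (prob ?A + prob ?B)"
          by (intro order_trans[OF measure_Un_le] add_left_mono measure_Un_le) measurable
        also have "prob ?A + prob ?B \<le> e"
          using KY KZ tail[OF Y(1), of K\<^sub>Y ?u] tail[OF Z(1), of K\<^sub>Z ?u] by simp
        finally show ?thesis by simp
      qed
      moreover have "(\<lambda>n. prob (?P n) + e) \<longlonglongrightarrow> 0 + e"
        by (intro tendsto_add tendsto_const prob_product_tendsto_zero c)
      ultimately show ?thesis
        by (intro LIMSEQ_le_const) auto
    qed
    then have "prob ?D \<le> 0"
      by (rule field_le_epsilon)
    then have "prob ?D = 0"
      using measure_nonneg by (rule antisym)
    then have "AE \<omega> in M. \<omega> \<notin> ?D"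
      by (subst (asm) prob_eq_0) auto
    then show ?thesis
      using AE_space by eventually_elim auto
  qed
  \<comment> \<open>Restricting \<open>\<delta>\<close> to the sequence \<open>1 / (n + 1)\<close>
    leaves countably many null sets to unite.\<close>
  then have "AE \<omega> in M. \<forall>n. \<bar>Z t \<omega> - Y t \<omega>\<bar> \<le> 1 / real (Suc n)"
    by (simp add: AE_all_countable)
  then show ?thesis
  proof eventually_elim
    case (elim \<omega>)
    have "(\<lambda>n. 1 / real (Suc n)) \<longlonglongrightarrow> 0"
      using LIMSEQ_inverse_real_of_nat by (simp add: inverse_eq_divide)
    then have "\<bar>Z t \<omega> - Y t \<omega>\<bar> \<le> 0"
      using elim by (intro LIMSEQ_le_const) auto
    then show ?case by simp
  qed
qed

end
end

section \<open>Existence, ergodicity and the series representation\<close>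

theorem theorem1:
  fixes M :: "'a measure"
    and \<epsilon> :: "int \<Rightarrow> 'a \<Rightarrow> real"
    and \<sigma> \<mu> \<phi> b :: real
  assumes "prob_space M"
    and "prob_space.indep_vars M (\<lambda>_. borel) \<epsilon> UNIV"
    and "\<And>s t. distr M borel (\<epsilon> s) = distr M borel (\<epsilon> t)"
    and "\<And>t. integrable M (\<epsilon> t)"
    and "\<And>t. integrable M (\<lambda>\<omega>. (\<epsilon> t \<omega>)\<^sup>2)"
    and "\<And>t. prob_space.expectation M (\<epsilon> t) = 0"
    and "\<And>t. prob_space.variance M (\<epsilon> t) = \<sigma>\<^sup>2"
    and "0 < \<sigma>\<^sup>2"
    and "ereal_expectation M (\<lambda>\<omega>. ereal_ln \<bar>\<phi> + b * \<epsilon> 1 \<omega>\<bar>) < 0"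
  shows "\<exists>Y. strictly_stationary M Y \<and> bilinear_solution M \<epsilon> \<mu> \<phi> b Y \<and>
           (\<forall>Z. strictly_stationary M Z \<and> bilinear_solution M \<epsilon> \<mu> \<phi> b Z \<longrightarrow>
              (\<forall>t. AE \<omega> in M. Z t \<omega> = Y t \<omega>)) \<and>
           ergodic_process M Y \<and>
           (\<forall>t. AE \<omega> in M.
              summable (\<lambda>i. series_term \<epsilon> \<mu> \<phi> b t \<omega> (Suc i)) \<and>
              Y t \<omega> = \<mu> + \<epsilon> t \<omega> + (\<Sum>i. series_term \<epsilon> \<mu> \<phi> b t \<omega> (Suc i)))"
proof -
  interpret prob_space M by fact
  note indep = assms(2) and ident = assms(3)
  have [measurable]: "\<epsilon> t \<in> borel_measurable M" for t
    using assms(4) by blast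
  obtain s where s: "0 < s" "s \<le> 1" and "expectation (\<lambda>\<omega>. \<bar>\<phi> + b * \<epsilon> 1 \<omega>\<bar> powr s) < 1"
    using exists_fractional_moment_less_one[of "\<lambda>\<omega>. \<bar>\<phi> + b * \<epsilon> 1 \<omega>\<bar>"] assms(4,9) by auto
  \<comment> \<open>The logarithmic condition concerns time 1, the contraction assumption time 0;
    both moments depend only on the common law of the noise.\<close>
  moreover have "expectation (\<lambda>\<omega>. \<bar>\<phi> + b * \<epsilon> t \<omega>\<bar> powr s) =
      (\<integral>x. \<bar>\<phi> + b * x\<bar> powr s \<partial>distr M borel (\<epsilon> t))" for t
    by (subst integral_distr) auto
  ultimately have contraction: "expectation (\<lambda>\<omega>. \<bar>\<phi> + b * \<epsilon> 0 \<omega>\<bar> powr s) < 1"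
    using ident[of 0 1] by simp
  note model = indep ident assms(4)[of 0] s contraction
  \<comment> \<open>The series at time 0 as a function of the noise path. It is defined and
    measurable on all paths, including those where the series diverges, so \<open>Y\<close> is a
    factor of the noise everywhere.\<close>
  define G where "G x = \<mu> + x 0 + (\<Sum>i. series_term (\<lambda>k y. y k) \<mu> \<phi> b 0 x (Suc i))" for x :: "int \<Rightarrow> real"
  have G: "G \<in> borel_measurable (PiM UNIV (\<lambda>_. borel))"
    unfolding G_def series_term_def by measurable
  define Y where "Y = (\<lambda>t \<omega>. G (\<lambda>k. \<epsilon> (t + k) \<omega>))"
  have Y: "Y t \<omega> = \<mu> + \<epsilon> t \<omega> + (\<Sum>i. series_term \<epsilon> \<mu> \<phi> b t \<omega> (Suc i))" for t \<omega>
    by (simp add: Y_def G_def series_term_def algebra_simps)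
  have stat: "strictly_stationary M Y"
    unfolding Y_def by (rule stationary_iid_factor[OF indep ident G])
  have erg: "ergodic_process M Y"
    unfolding Y_def by (rule ergodic_iid_factor[OF indep ident G])
  have summable: "AE \<omega> in M. summable (series_term \<epsilon> \<mu> \<phi> b t \<omega>)" for t
    by (rule AE_summable_series_term[OF model])
  \<comment> \<open>Splitting off the coefficient with \<open>r = 0\<close> moves the remaining
    summand two time steps back.\<close>
  have rec: "series_term \<epsilon> \<mu> \<phi> b t \<omega> (Suc i) =
      (\<phi> + b * \<epsilon> (t - 1) \<omega>) * series_term \<epsilon> \<mu> \<phi> b (t - 2) \<omega> i" for t \<omega> i
  proof -
    have "(\<Prod>r<Suc i. \<phi> + b * \<epsilon> (t - 2 * int r - 1) \<omega>) =
        (\<phi> + b * \<epsilon> (t - 1) \<omega>) * (\<Prod>r<i. \<phi> + b * \<epsilon> (t - 2 - 2 * int r - 1) \<omega>)"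
      by (subst prod.lessThan_Suc_shift) (simp add: algebra_simps)
    moreover have "t - 2 * int (Suc i) = t - 2 - 2 * int i"
      by simp
    ultimately show ?thesis
      by (simp only: series_term_def mult.assoc)
  qed
  have sol: "bilinear_solution M \<epsilon> \<mu> \<phi> b Y"
    unfolding bilinear_solution_def
  proof (intro conjI allI)
    show "Y t \<in> borel_measurable M" for t
      using stat by (simp add: strictly_stationary_def)
    fix t
    show "AE \<omega> in M. Y t \<omega> = \<mu> + \<phi> * Y (t - 2) \<omega> + b * Y (t - 2) \<omega> * \<epsilon> (t - 1) \<omega> + \<epsilon> t \<omega>"
      using summable[of "t - 2"]
    proof eventually_elim
      case (elim \<omega>)
      \<comment> \<open>The empty product makes the summand with index 0 equal to
        \<open>\<mu> + \<epsilon> (t - 2)\<close>, so the terms outside the series are absorbed into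
        a sum from 0.\<close>
      have "Y (t - 2) \<omega> = (\<Sum>i. series_term \<epsilon> \<mu> \<phi> b (t - 2) \<omega> i)"
        unfolding Y suminf_split_head[OF elim] by (simp add: series_term_def[where i = 0])
      moreover have "Y t \<omega> = \<mu> + \<epsilon> t \<omega> + (\<phi> + b * \<epsilon> (t - 1) \<omega>) * (\<Sum>i. series_term \<epsilon> \<mu> \<phi> b (t - 2) \<omega> i)"
        by (simp only: Y rec suminf_mult[OF elim])
      ultimately show ?case
        by (simp add: algebra_simps)
    qed
  qed
  show ?thesis
  proof (intro exI[of _ Y] conjI allI impI)
    show "AE \<omega> in M. Z t \<omega> = Y t \<omega>" if "strictly_stationary M Z \<and> bilinear_solution M \<epsilon> \<mu> \<phi> b Z" for Z t
      using that by (intro stationary_solution_unique[OF model stat sol]) auto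
    show "AE \<omega> in M. summable (\<lambda>i. series_term \<epsilon> \<mu> \<phi> b t \<omega> (Suc i)) \<and>
        Y t \<omega> = \<mu> + \<epsilon> t \<omega> + (\<Sum>i. series_term \<epsilon> \<mu> \<phi> b t \<omega> (Suc i))" for t
      using summable[of t] by eventually_elim (simp add: Y summable_Suc_iff)
  qed (fact stat sol erg)+
qed

end
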